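(* Fix an even integer $d\geq 2$. Let $P$ and $Q$ be Borel probability measures on $\mathbb{R}^d$, and $\Omega\subset\mathbb{R}^d$ a nonempty open subset. If $P=Q$ on $\Omega$ (i.e. $P(E)=Q(E)$ for all Borel $E\subset\Omega$) and $F_P^{\mathrm g}=F_Q^{\mathrm g}$ on $\Omega$, then $P=Q$ on $\mathbb{R}^d$.
   Context: For a Borel probability measure $P$ on $\mathbb{R}^d$, the geometric cdf $F_P^{\mathrm g}:\mathbb{R}^d\to\mathbb{R}^d$ is $F_P^{\mathrm g}(x)=\mathbb{E}\big[\frac{x-Z}{\|x-Z\|}\mathbb{I}[Z\neq x]\big]$, where $Z$ is a random vector with law $P$ and $\|\cdot\|$ is the Euclidean norm. *)

theory Defs
  imports "HOL-Probability.Probability"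
begin

text \<open>The random vector \<open>Z\<close> with law \<open>P\<close> is taken to be the identity on the probability
  space \<open>P\<close>. The integrand is bounded by 1 in norm and Borel measurable, so the Bochner integral
  is meaningful for every Borel probability measure \<open>P\<close>.\<close>

definition geometric_cdf :: "(real ^ 'n) measure \<Rightarrow> real ^ 'n \<Rightarrow> real ^ 'n" where
  "geometric_cdf P x =
     (\<integral>z. indicator {z. z \<noteq> x} z *\<^sub>R ((x - z) /\<^sub>R norm (x - z)) \<partial>P)"

end

theory Submission
  imports Defs
begin

text \<open>
  Write \<open>\<mu> = P - Q\<close> and \<open>F\<close> for the difference of the two geometric cdfs. Since \<open>\<mu>\<close> vanishes
  on a ball \<open>B \<subseteq> \<Omega>\<close>, for centres \<open>x\<close> in the smaller concentric ball \<open>U\<close> all kernels below are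
  bounded on the support of \<open>\<mu>\<close> and may be differentiated under the integral sign. The kernel of
  \<open>F\<close> is the gradient of \<open>\<bar>x - z\<bar>\<close>, and
  \<open>div (\<bar>v\<bar>\<^sup>a\<^sup>-\<^sup>2 v) = (d + a - 2) \<bar>v\<bar>\<^sup>a\<^sup>-\<^sup>2\<close>. Alternating divergence and gradient, \<open>F = 0\<close> on \<open>U\<close>
  yields that the integral of \<open>\<bar>x - z\<bar>\<close> to the power \<open>- 1 - 2 m\<close> against \<open>\<mu>\<close> vanishes for every
  \<open>m\<close> and every \<open>x\<close> in \<open>U\<close>. This is where the parity of \<open>d\<close> enters: the factors that have to be
  cancelled are \<open>d - 1 - 2 m\<close>, which never vanish for even \<open>d\<close> (\<open>integral_norm_odd_powr_eq\<close>).

  Fix \<open>x\<close> in \<open>U\<close>. In the variable \<open>u = 1 / \<bar>x - z\<bar>\<^sup>2\<close>, which stays in a compact interval, these are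
  all the moments of a finite signed measure, so the Weierstrass theorem gives
  \<open>\<integral> exp (- t \<bar>x - z\<bar>\<^sup>2) d\<mu> = 0\<close> for all \<open>t > 0\<close> (\<open>integral_gaussian_eq\<close>).

  Finally, the product of two Gaussians is a multiple of a Gaussian whose centre is a convex
  combination of the two centres. Hence the constants and the Gaussians with centres in the convex
  set \<open>U\<close> span an algebra of functions that are continuous on the one-point compactification, and
  this algebra separates points. By the Stone-Weierstrass theorem it is dense, so \<open>\<mu> = 0\<close>
  (\<open>measure_eqI_gaussian\<close>).
\<close>

section \<open>Tools for comparing integrals against two measures\<close>

lemma has_real_derivative_integral:
  fixes K D :: "real \<Rightarrow> 'b \<Rightarrow> real"
  assumes "finite_measure M" and "0 < \<delta>"
    and int: "\<And>t. \<bar>t\<bar> < \<delta> \<Longrightarrow> integrable M (K t)"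
    and der: "\<And>t z. \<bar>t\<bar> < \<delta> \<Longrightarrow> z \<in> space M \<Longrightarrow> ((\<lambda>t. K t z) has_real_derivative D t z) (at t)"
    and bnd: "\<And>t z. \<bar>t\<bar> < \<delta> \<Longrightarrow> z \<in> space M \<Longrightarrow> \<bar>D t z\<bar> \<le> C"
  shows "((\<lambda>t. \<integral>z. K t z \<partial>M) has_real_derivative (\<integral>z. D 0 z \<partial>M)) (at 0)"
proof -
  interpret finite_measure M by fact
  have "(\<lambda>n. ((\<integral>z. K (X n) z \<partial>M) - (\<integral>z. K 0 z \<partial>M)) / X n) \<longlonglongrightarrow> (\<integral>z. D 0 z \<partial>M)"
    if X0: "\<And>n. X n \<noteq> 0" and X: "X \<longlonglongrightarrow> 0" for X :: "nat \<Rightarrow> real"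
  proof -
    from X \<open>0 < \<delta>\<close> obtain N where N: "\<And>n. N \<le> n \<Longrightarrow> \<bar>X n\<bar> < \<delta>"
      by (metis LIMSEQ_iff diff_zero real_norm_def)
    define Y where "Y n = X (n + N)" for n
    have Y: "Y n \<noteq> 0" "\<bar>Y n\<bar> < \<delta>" for n
      using X0 N by (auto simp: Y_def)
    have Ylim: "Y \<longlonglongrightarrow> 0"
      unfolding Y_def by (rule LIMSEQ_ignore_initial_segment[OF X])
    \<comment> \<open>The mean value theorem bounds the difference quotients by \<open>C\<close>, so dominated convergence applies.\<close>
    let ?s = "\<lambda>n z. (K (Y n) z - K 0 z) / Y n"
    have s_meas [measurable]: "?s n \<in> borel_measurable M" for n
      using int[OF Y(2)] int[of 0] \<open>0 < \<delta>\<close> by (auto dest!: borel_measurable_integrable)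
    have s_lim: "(\<lambda>n. ?s n z) \<longlonglongrightarrow> D 0 z" if "z \<in> space M" for z
    proof -
      have "((\<lambda>t. (K t z - K 0 z) / t) \<longlongrightarrow> D 0 z) (at 0)"
        using der[of 0 z] that \<open>0 < \<delta>\<close> by (simp add: has_field_derivative_iff)
      then show ?thesis
        using Ylim Y(1) by (force simp: tendsto_at_iff_sequentially o_def)
    qed
    have s_bnd: "norm (?s n z) \<le> C" if "z \<in> space M" for n z
    proof -
      have "norm (K (Y n) z - K 0 z) \<le> C * norm (Y n - 0)"
      proof (rule field_differentiable_bound[where S = "{-\<delta><..<\<delta>}" and f' = "\<lambda>t. D t z"])
        show "((\<lambda>t. K t z) has_field_derivative D t z) (at t within {-\<delta><..<\<delta>})"
          if "t \<in> {-\<delta><..<\<delta>}" for t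
          using der[of t z] \<open>z \<in> space M\<close> that by (auto intro: has_field_derivative_at_within)
      qed (use Y(2)[of n] \<open>0 < \<delta>\<close> bnd \<open>z \<in> space M\<close> in auto)
      then show ?thesis using Y(1)[of n] by (simp add: field_simps)
    qed
    have D_meas: "D 0 \<in> borel_measurable M"
      by (rule borel_measurable_LIMSEQ_real[OF s_lim s_meas])
    have "(\<lambda>n. \<integral>z. ?s n z \<partial>M) \<longlonglongrightarrow> (\<integral>z. D 0 z \<partial>M)"
      by (rule integral_dominated_convergence[where w = "\<lambda>_. C"])
         (use s_lim s_bnd D_meas in auto)
    moreover have "(\<integral>z. ?s n z \<partial>M) = ((\<integral>z. K (Y n) z \<partial>M) - (\<integral>z. K 0 z \<partial>M)) / Y n" for n
      using int[OF Y(2)] int[of 0] \<open>0 < \<delta>\<close> by simp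
    ultimately have "(\<lambda>n. ((\<integral>z. K (Y n) z \<partial>M) - (\<integral>z. K 0 z \<partial>M)) / Y n) \<longlonglongrightarrow> (\<integral>z. D 0 z \<partial>M)"
      by (simp only:)
    then show ?thesis unfolding Y_def by (rule LIMSEQ_offset)
  qed
  then show ?thesis
    by (simp add: has_field_derivative_iff tendsto_at_iff_sequentially o_def)
qed

text \<open>
  If a parametrised kernel has equal integrals for all small parameters, both integrals are the same
  function of the parameter near \<open>0\<close>, and so have the same derivative there.
\<close>

lemma integral_derivative_eq:
  fixes K D :: "real \<Rightarrow> 'b \<Rightarrow> real"
  assumes "finite_measure M" "finite_measure N" and "0 < \<delta>"
    and "\<And>t. \<bar>t\<bar> < \<delta> \<Longrightarrow> integrable M (K t)" "\<And>t. \<bar>t\<bar> < \<delta> \<Longrightarrow> integrable N (K t)"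
    and "\<And>t z. \<bar>t\<bar> < \<delta> \<Longrightarrow> z \<in> space M \<union> space N \<Longrightarrow> ((\<lambda>t. K t z) has_real_derivative D t z) (at t)"
    and "\<And>t z. \<bar>t\<bar> < \<delta> \<Longrightarrow> z \<in> space M \<union> space N \<Longrightarrow> \<bar>D t z\<bar> \<le> C"
    and eq: "\<And>t. \<bar>t\<bar> < \<delta> \<Longrightarrow> (\<integral>z. K t z \<partial>M) = (\<integral>z. K t z \<partial>N)"
  shows "(\<integral>z. D 0 z \<partial>M) = (\<integral>z. D 0 z \<partial>N)"
proof (rule DERIV_unique)
  show "((\<lambda>t. \<integral>z. K t z \<partial>M) has_real_derivative (\<integral>z. D 0 z \<partial>M)) (at 0)"
    by (rule has_real_derivative_integral[where \<delta> = \<delta> and C = C]) (use assms in auto)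
  have "((\<lambda>t. \<integral>z. K t z \<partial>N) has_real_derivative (\<integral>z. D 0 z \<partial>N)) (at 0)"
    by (rule has_real_derivative_integral[where \<delta> = \<delta> and C = C]) (use assms in auto)
  then show "((\<lambda>t. \<integral>z. K t z \<partial>M) has_real_derivative (\<integral>z. D 0 z \<partial>N)) (at 0)"
    by (rule has_field_derivative_transform_within_open[where S = "{-\<delta><..<\<delta>}"])
       (use eq \<open>0 < \<delta>\<close> in auto)
qed

lemma integral_eq_of_uniform_approx:
  fixes f :: "'b \<Rightarrow> real"
  assumes "finite_measure M" "finite_measure N"
    and f: "integrable M f" "integrable N f"
    and approx: "\<And>e. 0 < e \<Longrightarrow> \<exists>g. integrable M g \<and> integrable N g \<and> integral\<^sup>L M g = integral\<^sup>L N g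
                   \<and> (\<forall>z \<in> space M \<union> space N. \<bar>f z - g z\<bar> \<le> e)"
  shows "integral\<^sup>L M f = integral\<^sup>L N f"
proof -
  interpret M: finite_measure M by fact
  interpret N: finite_measure N by fact
  define m where "m = measure M (space M) + measure N (space N) + 1"
  have "m > 0" unfolding m_def by (simp add: add_nonneg_pos)
  have "\<bar>integral\<^sup>L M f - integral\<^sup>L N f\<bar> \<le> 0 + e" if "e > 0" for e
  proof -
    obtain g where g: "integrable M g" "integrable N g" "integral\<^sup>L M g = integral\<^sup>L N g"
      and fg: "\<And>z. z \<in> space M \<union> space N \<Longrightarrow> \<bar>f z - g z\<bar> \<le> e / m"
      using approx[of "e / m"] \<open>e > 0\<close> \<open>m > 0\<close> by auto
    have 1: "\<bar>integral\<^sup>L L f - integral\<^sup>L L g\<bar> \<le> e / m * measure L (space L)"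
      if "finite_measure L" "integrable L f" "integrable L g"
         "\<And>z. z \<in> space L \<Longrightarrow> \<bar>f z - g z\<bar> \<le> e / m" for L
    proof -
      interpret L: finite_measure L by fact
      have "\<bar>integral\<^sup>L L f - integral\<^sup>L L g\<bar> = \<bar>\<integral>z. f z - g z \<partial>L\<bar>"
        using that by simp
      also have "\<dots> \<le> (\<integral>z. \<bar>f z - g z\<bar> \<partial>L)"
        by (rule integral_abs_bound)
      also have "\<dots> \<le> (\<integral>z. e / m \<partial>L)"
        by (rule integral_mono) (use that in auto)
      finally show ?thesis by (simp add: mult.commute)
    qed
    have "\<bar>integral\<^sup>L M f - integral\<^sup>L N f\<bar> \<le> e / m * measure M (space M) + e / m * measure N (space N)"
      using 1[of M] 1[of N] assms(1,2) f g fg by fastforce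
    also have "\<dots> \<le> e / m * m"
      unfolding distrib_left[symmetric]
      by (rule mult_left_mono) (use \<open>e > 0\<close> \<open>m > 0\<close> in \<open>auto simp: m_def\<close>)
    finally show ?thesis using \<open>m > 0\<close> by simp
  qed
  then have "\<bar>integral\<^sup>L M f - integral\<^sup>L N f\<bar> \<le> 0" by (rule field_le_epsilon)
  then show ?thesis by simp
qed

text \<open>
  The indicator of a closed set \<open>A\<close> is the decreasing limit of the continuous functions
  \<open>max 0 (1 - n infdist z A)\<close>, so the measures agree on closed sets, an intersection-stable generator
  of the Borel sets.
\<close>

lemma measure_eqI_continuous_bounded:
  fixes M N :: "'b::metric_space measure"
  assumes "finite_measure M" "finite_measure N" and M: "sets M = sets borel" and N: "sets N = sets borel"
    and eq: "\<And>f. continuous_on UNIV f \<Longrightarrow> bounded (range f) \<Longrightarrow> (\<integral>z. f z \<partial>M) = (\<integral>z. f z \<partial>N :: real)"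
  shows "M = N"
proof -
  interpret M: finite_measure M by fact
  interpret N: finite_measure N by fact
  have closed: "emeasure M A = emeasure N A" if "closed A" "A \<noteq> {}" for A
  proof -
    define f where "f n z = max 0 (1 - real n * infdist z A)" for n z
    have cont: "continuous_on UNIV (f n)" for n
      unfolding f_def by (intro continuous_intros)
    have f01: "0 \<le> f n z" "f n z \<le> 1" for n z
      by (auto simp: f_def infdist_nonneg)
    have lim: "(\<lambda>n. f n z) \<longlonglongrightarrow> indicator A z" for z
    proof (cases "z \<in> A")
      case True
      then show ?thesis by (simp add: f_def)
    next
      case False
      then have pos: "infdist z A > 0"
        using that by (simp add: infdist_pos_not_in_closed)
      obtain n0 where n0: "1 \<le> real n0 * infdist z A"
        using reals_Archimedean3[OF pos] by (meson less_imp_le)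
      have "f n z = 0" if "n \<ge> n0" for n
      proof -
        have "real n0 * infdist z A \<le> real n * infdist z A"
          using that pos by (intro mult_right_mono) auto
        then show ?thesis using n0 by (simp add: f_def)
      qed
      then have "\<forall>\<^sub>F n in sequentially. f n z = indicator A z"
        using False by (auto simp: eventually_sequentially)
      then show ?thesis by (rule tendsto_eventually)
    qed
    have conv: "(\<lambda>n. \<integral>z. f n z \<partial>L) \<longlonglongrightarrow> measure L A"
      if "finite_measure L" "sets L = sets borel" for L
    proof -
      interpret L: finite_measure L by fact
      note [measurable_cong] = that(2)
      have [measurable]: "A \<in> sets L" "A \<in> sets borel"
        using \<open>closed A\<close> that(2) by auto
      have [measurable]: "f n \<in> borel_measurable borel" for n
        by (rule borel_measurable_continuous_onI[OF cont])
      have "(\<lambda>n. \<integral>z. f n z \<partial>L) \<longlonglongrightarrow> (\<integral>z. indicator A z \<partial>L)"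
        by (rule integral_dominated_convergence[where w = "\<lambda>_. 1"]) (use f01 lim in auto)
      then show ?thesis
        using sets_eq_imp_space_eq[OF that(2)] by simp
    qed
    have "measure M A = measure N A"
    proof (rule LIMSEQ_unique[OF conv])
      have "bounded (range (f n))" for n
        using f01 by (auto simp: bounded_iff intro!: exI[of _ 1])
      then show "(\<lambda>n. \<integral>z. f n z \<partial>M) \<longlonglongrightarrow> measure N A"
        using conv[OF \<open>finite_measure N\<close> N] eq[OF cont] by simp
    qed (use assms in auto)
    then show ?thesis by (simp add: M.emeasure_eq_measure N.emeasure_eq_measure)
  qed
  show ?thesis
  proof (rule measure_eqI_generator_eq[where E = "Collect closed" and \<Omega> = UNIV and A = "\<lambda>_. UNIV"])
    show "emeasure M X = emeasure N X" if "X \<in> Collect closed" for X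
      using closed[of X] that by (cases "X = {}") auto
    show "sets M = sigma_sets UNIV (Collect closed)" "sets N = sigma_sets UNIV (Collect closed)"
      using M N by (simp_all add: borel_eq_closed)
  qed (auto simp: Int_stable_def M.emeasure_eq_measure)
qed

section \<open>Radial kernels: gradients and divergences under the integral\<close>

lemma has_real_derivative_norm_powr_line:
  fixes v b :: "'a::euclidean_space"
  assumes "v + t *\<^sub>R b \<noteq> 0"
  shows "((\<lambda>t. norm (v + t *\<^sub>R b) powr a) has_real_derivative
           a * norm (v + t *\<^sub>R b) powr (a - 2) * ((v + t *\<^sub>R b) \<bullet> b)) (at t)"
proof -
  let ?w = "v + t *\<^sub>R b"
  have pos: "norm ?w > 0" using assms by simp
  have "((\<lambda>t. norm (v + t *\<^sub>R b)) has_derivative (\<lambda>h. (h *\<^sub>R b) \<bullet> sgn ?w)) (at t)"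
  proof (rule has_derivative_compose[where f = "\<lambda>t. v + t *\<^sub>R b" and g = norm])
    show "((\<lambda>t. v + t *\<^sub>R b) has_derivative (\<lambda>h. h *\<^sub>R b)) (at t)"
      by (auto intro!: derivative_eq_intros)
  qed (rule has_derivative_norm[OF assms])
  moreover have "(\<lambda>h. (h *\<^sub>R b) \<bullet> sgn ?w) = (\<lambda>h. (?w \<bullet> b / norm ?w) * h)"
    by (rule ext) (simp add: sgn_div_norm inner_commute divide_inverse mult_ac)
  ultimately have "((\<lambda>t. norm (v + t *\<^sub>R b)) has_real_derivative (?w \<bullet> b / norm ?w)) (at t)"
    by (simp only: has_field_derivative_def)
  then have "((\<lambda>t. norm (v + t *\<^sub>R b) powr a) has_real_derivative
      norm ?w powr a * (0 * ln (norm ?w) + (?w \<bullet> b / norm ?w) * a / norm ?w)) (at t)"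
    using pos by (intro DERIV_powr) auto
  moreover have "norm ?w powr (a - 2) = norm ?w powr a / norm ?w / norm ?w"
    using pos by (simp add: powr_diff field_simps power2_eq_square)
  ultimately show ?thesis by (simp add: field_simps)
qed

text \<open>
  Differentiating in direction \<open>b\<close> turns the kernel \<open>\<bar>x - z\<bar>\<^sup>a\<close> into
  \<open>a \<bar>x - z\<bar>\<^sup>a\<^sup>-\<^sup>2 ((x - z) \<bullet> b)\<close>, which is bounded because \<open>z\<close> stays away from \<open>x\<close> and \<open>a < 0\<close>.
\<close>

lemma integral_gradient_norm_powr_eq:
  fixes M N :: "'a::euclidean_space measure" and a :: real
  assumes fin: "finite_measure M" "finite_measure N"
    and meas [measurable]: "(\<lambda>z. z) \<in> borel_measurable M" "(\<lambda>z. z) \<in> borel_measurable N"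
    and "open U" "0 < \<epsilon>" and far: "\<And>x z. x \<in> U \<Longrightarrow> z \<in> space M \<union> space N \<Longrightarrow> \<epsilon> \<le> norm (x - z)"
    and "a < 0" and b: "norm b = 1"
    and eq: "\<And>x. x \<in> U \<Longrightarrow> (\<integral>z. norm (x - z) powr a \<partial>M) = (\<integral>z. norm (x - z) powr a \<partial>N)"
    and x: "x \<in> U"
  shows "(\<integral>z. norm (x - z) powr (a - 2) * ((x - z) \<bullet> b) \<partial>M)
       = (\<integral>z. norm (x - z) powr (a - 2) * ((x - z) \<bullet> b) \<partial>N)"
proof -
  interpret M: finite_measure M by fact
  interpret N: finite_measure N by fact
  obtain \<delta> where \<delta>: "0 < \<delta>" "ball x \<delta> \<subseteq> U"
    using \<open>open U\<close> x by (auto simp: open_contains_ball)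
  have inU: "x + t *\<^sub>R b \<in> U" if "\<bar>t\<bar> < \<delta>" for t
  proof -
    have "dist x (x + t *\<^sub>R b) = \<bar>t\<bar>" using b by (simp add: dist_norm)
    then show ?thesis using \<delta>(2) that by auto
  qed
  have shift: "x + t *\<^sub>R b - z = (x - z) + t *\<^sub>R b" for t z by simp
  have far': "\<epsilon> \<le> norm ((x - z) + t *\<^sub>R b)" if "\<bar>t\<bar> < \<delta>" "z \<in> space M \<union> space N" for t z
    using far[OF inU[OF that(1)] that(2)] by (simp add: shift)
  have pow_bnd: "norm ((x - z) + t *\<^sub>R b) powr c \<le> \<epsilon> powr c"
    if "\<bar>t\<bar> < \<delta>" "z \<in> space M \<union> space N" "c \<le> 0" for t z c
    using far'[OF that(1,2)] \<open>0 < \<epsilon>\<close> that(3) by (intro powr_mono2') auto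
  have "(\<integral>z. a * norm ((x - z) + 0 *\<^sub>R b) powr (a - 2) * (((x - z) + 0 *\<^sub>R b) \<bullet> b) \<partial>M)
      = (\<integral>z. a * norm ((x - z) + 0 *\<^sub>R b) powr (a - 2) * (((x - z) + 0 *\<^sub>R b) \<bullet> b) \<partial>N)"
  proof (rule integral_derivative_eq[where \<delta> = \<delta> and K = "\<lambda>t z. norm ((x - z) + t *\<^sub>R b) powr a"
        and C = "\<bar>a\<bar> * \<epsilon> powr (a - 1)"])
    show "integrable M (\<lambda>z. norm ((x - z) + t *\<^sub>R b) powr a)" if "\<bar>t\<bar> < \<delta>" for t
      by (rule M.integrable_const_bound[where B = "\<epsilon> powr a"]) (use pow_bnd that \<open>a < 0\<close> in auto)
    show "integrable N (\<lambda>z. norm ((x - z) + t *\<^sub>R b) powr a)" if "\<bar>t\<bar> < \<delta>" for t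
      by (rule N.integrable_const_bound[where B = "\<epsilon> powr a"]) (use pow_bnd that \<open>a < 0\<close> in auto)
    show "((\<lambda>t. norm ((x - z) + t *\<^sub>R b) powr a) has_real_derivative
        a * norm ((x - z) + t *\<^sub>R b) powr (a - 2) * (((x - z) + t *\<^sub>R b) \<bullet> b)) (at t)"
      if "\<bar>t\<bar> < \<delta>" "z \<in> space M \<union> space N" for t z
      using far'[OF that] \<open>0 < \<epsilon>\<close> by (intro has_real_derivative_norm_powr_line) auto
    show "\<bar>a * norm ((x - z) + t *\<^sub>R b) powr (a - 2) * (((x - z) + t *\<^sub>R b) \<bullet> b)\<bar> \<le> \<bar>a\<bar> * \<epsilon> powr (a - 1)"
      if "\<bar>t\<bar> < \<delta>" "z \<in> space M \<union> space N" for t z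
    proof -
      let ?w = "(x - z) + t *\<^sub>R b"
      have pos: "norm ?w > 0" using far'[OF that] \<open>0 < \<epsilon>\<close> by linarith
      have "norm ?w powr (a - 2) * \<bar>?w \<bullet> b\<bar> \<le> norm ?w powr (a - 2) * norm ?w"
        using Cauchy_Schwarz_ineq2[of ?w b] b by (intro mult_left_mono) auto
      also have "\<dots> = norm ?w powr (a - 1)"
        using pos by (simp add: powr_diff field_simps power2_eq_square)
      also have "\<dots> \<le> \<epsilon> powr (a - 1)"
        by (rule pow_bnd) (use that \<open>a < 0\<close> in auto)
      finally show ?thesis by (simp add: abs_mult mult.assoc mult_left_mono)
    qed
    show "(\<integral>z. norm ((x - z) + t *\<^sub>R b) powr a \<partial>M) = (\<integral>z. norm ((x - z) + t *\<^sub>R b) powr a \<partial>N)"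
      if "\<bar>t\<bar> < \<delta>" for t
      using eq[OF inU[OF that]] by (simp add: shift)
  qed (use fin \<delta> in auto)
  then show ?thesis using \<open>a < 0\<close> by (simp add: mult.assoc)
qed

text \<open>
  The converse passage: summing the derivatives of the components of the field
  \<open>\<bar>x - z\<bar>\<^sup>a\<^sup>-\<^sup>2 (x - z)\<close> produces \<open>(d + a - 2) \<bar>x - z\<bar>\<^sup>a\<^sup>-\<^sup>2\<close>, and the factor is cancelled. The bound
  \<open>a \<le> 1\<close> keeps the field itself bounded away from the singularity.
\<close>

lemma integral_divergence_norm_powr_eq:
  fixes M N :: "'a::euclidean_space measure" and a :: real
  assumes fin: "finite_measure M" "finite_measure N"
    and meas [measurable]: "(\<lambda>z. z) \<in> borel_measurable M" "(\<lambda>z. z) \<in> borel_measurable N"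
    and "open U" "0 < \<epsilon>" and far: "\<And>x z. x \<in> U \<Longrightarrow> z \<in> space M \<union> space N \<Longrightarrow> \<epsilon> \<le> norm (x - z)"
    and "a \<le> 1" and dim: "real DIM('a) + a \<noteq> 2"
    and eq: "\<And>x b. x \<in> U \<Longrightarrow> b \<in> Basis \<Longrightarrow>
       (\<integral>z. norm (x - z) powr (a - 2) * ((x - z) \<bullet> b) \<partial>M) = (\<integral>z. norm (x - z) powr (a - 2) * ((x - z) \<bullet> b) \<partial>N)"
    and x: "x \<in> U"
  shows "(\<integral>z. norm (x - z) powr (a - 2) \<partial>M) = (\<integral>z. norm (x - z) powr (a - 2) \<partial>N)"
proof -
  interpret M: finite_measure M by fact
  interpret N: finite_measure N by fact
  obtain \<delta> where \<delta>: "0 < \<delta>" "ball x \<delta> \<subseteq> U"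
    using \<open>open U\<close> x by (auto simp: open_contains_ball)
  have inU: "x + t *\<^sub>R b \<in> U" if "\<bar>t\<bar> < \<delta>" "b \<in> Basis" for t b
  proof -
    have "dist x (x + t *\<^sub>R b) = \<bar>t\<bar>" using that by (simp add: dist_norm)
    then show ?thesis using \<delta>(2) that by auto
  qed
  have shift: "x + t *\<^sub>R b - z = (x - z) + t *\<^sub>R b" for t b z by simp
  have far': "\<epsilon> \<le> norm ((x - z) + t *\<^sub>R b)" if "\<bar>t\<bar> < \<delta>" "z \<in> space M \<union> space N" "b \<in> Basis" for t z b
    using far[OF inU[OF that(1,3)] that(2)] by (simp add: shift)
  have pow_bnd: "norm ((x - z) + t *\<^sub>R b) powr c \<le> \<epsilon> powr c"
    if "\<bar>t\<bar> < \<delta>" "z \<in> space M \<union> space N" "b \<in> Basis" "c \<le> 0" for t z b c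
    using far'[OF that(1,2,3)] \<open>0 < \<epsilon>\<close> that(4) by (intro powr_mono2') auto
  \<comment> \<open>\<open>D b\<close> is the derivative in direction \<open>b\<close> of the \<open>b\<close>-component of the field \<open>\<bar>w\<bar>\<^sup>a\<^sup>-\<^sup>2 w\<close>.\<close>
  define D where "D b w = norm w powr (a - 2) + (a - 2) * norm w powr (a - 4) * (w \<bullet> b)\<^sup>2" for b w :: 'a
  have [measurable]: "D b \<in> borel_measurable borel" for b
    unfolding D_def by measurable
  have D_bnd: "\<bar>D b ((x - z) + t *\<^sub>R b)\<bar> \<le> (1 + \<bar>a - 2\<bar>) * \<epsilon> powr (a - 2)"
    if "\<bar>t\<bar> < \<delta>" "z \<in> space M \<union> space N" "b \<in> Basis" for t z b
  proof -
    let ?w = "(x - z) + t *\<^sub>R b"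
    have pos: "norm ?w > 0" using far'[OF that] \<open>0 < \<epsilon>\<close> by linarith
    have "\<bar>?w \<bullet> b\<bar> \<le> norm ?w"
      using Cauchy_Schwarz_ineq2[of ?w b] that by auto
    then have "(?w \<bullet> b)\<^sup>2 \<le> (norm ?w)\<^sup>2"
      using abs_le_square_iff[of "?w \<bullet> b" "norm ?w"] by simp
    then have "norm ?w powr (a - 4) * (?w \<bullet> b)\<^sup>2 \<le> norm ?w powr (a - 4) * (norm ?w)\<^sup>2"
      by (intro mult_left_mono) auto
    also have "\<dots> = norm ?w powr (a - 2)"
      using powr_add[of "norm ?w" "a - 4" 2] pos by simp
    finally have "\<bar>(a - 2) * (norm ?w powr (a - 4) * (?w \<bullet> b)\<^sup>2)\<bar> \<le> \<bar>a - 2\<bar> * norm ?w powr (a - 2)"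
      by (simp add: abs_mult mult_left_mono)
    then have "\<bar>D b ?w\<bar> \<le> norm ?w powr (a - 2) + \<bar>a - 2\<bar> * norm ?w powr (a - 2)"
      unfolding D_def mult.assoc by (intro abs_triangle_ineq[THEN order_trans] add_mono) auto
    also have "\<dots> = (1 + \<bar>a - 2\<bar>) * norm ?w powr (a - 2)"
      by (simp add: distrib_right)
    also have "\<dots> \<le> (1 + \<bar>a - 2\<bar>) * \<epsilon> powr (a - 2)"
      by (intro mult_left_mono pow_bnd) (use that \<open>a \<le> 1\<close> in auto)
    finally show ?thesis .
  qed
  have D_eq: "(\<integral>z. D b (x - z) \<partial>M) = (\<integral>z. D b (x - z) \<partial>N)" if b: "b \<in> Basis" for b
  proof -
    let ?K = "\<lambda>t z. norm ((x - z) + t *\<^sub>R b) powr (a - 2) * (((x - z) + t *\<^sub>R b) \<bullet> b)"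
    have K_bnd: "\<bar>?K t z\<bar> \<le> \<epsilon> powr (a - 1)"
      if "\<bar>t\<bar> < \<delta>" "z \<in> space M \<union> space N" for t z
    proof -
      let ?w = "(x - z) + t *\<^sub>R b"
      have pos: "norm ?w > 0" using far'[OF that b] \<open>0 < \<epsilon>\<close> by linarith
      have "norm ?w powr (a - 2) * \<bar>?w \<bullet> b\<bar> \<le> norm ?w powr (a - 2) * norm ?w"
        using Cauchy_Schwarz_ineq2[of ?w b] b by (intro mult_left_mono) auto
      also have "\<dots> = norm ?w powr (a - 1)"
        using pos by (simp add: powr_diff field_simps power2_eq_square)
      also have "\<dots> \<le> \<epsilon> powr (a - 1)"
        by (rule pow_bnd) (use that b \<open>a \<le> 1\<close> in auto)
      finally show ?thesis by (simp add: abs_mult)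
    qed
    have "(\<integral>z. D b ((x - z) + 0 *\<^sub>R b) \<partial>M) = (\<integral>z. D b ((x - z) + 0 *\<^sub>R b) \<partial>N)"
    proof (rule integral_derivative_eq[where \<delta> = \<delta> and K = ?K and C = "(1 + \<bar>a - 2\<bar>) * \<epsilon> powr (a - 2)"])
      show "integrable M (?K t)" if "\<bar>t\<bar> < \<delta>" for t
        by (rule M.integrable_const_bound[where B = "\<epsilon> powr (a - 1)"]) (use K_bnd that in auto)
      show "integrable N (?K t)" if "\<bar>t\<bar> < \<delta>" for t
        by (rule N.integrable_const_bound[where B = "\<epsilon> powr (a - 1)"]) (use K_bnd that in auto)
      show "((\<lambda>t. ?K t z) has_real_derivative D b ((x - z) + t *\<^sub>R b)) (at t)"
        if "\<bar>t\<bar> < \<delta>" "z \<in> space M \<union> space N" for t z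
      proof -
        let ?w = "(x - z) + t *\<^sub>R b"
        have "((\<lambda>t. norm ((x - z) + t *\<^sub>R b) powr (a - 2)) has_real_derivative
            (a - 2) * norm ?w powr (a - 2 - 2) * (?w \<bullet> b)) (at t)"
          using far'[OF that b] \<open>0 < \<epsilon>\<close> by (intro has_real_derivative_norm_powr_line) auto
        moreover have "((\<lambda>t. ((x - z) + t *\<^sub>R b) \<bullet> b) has_real_derivative 1) (at t)"
          using b by (auto simp: inner_add_left intro!: derivative_eq_intros)
        ultimately show ?thesis
          unfolding D_def by (rule DERIV_cong[OF DERIV_mult]) (simp add: power2_eq_square algebra_simps)
      qed
      show "(\<integral>z. ?K t z \<partial>M) = (\<integral>z. ?K t z \<partial>N)" if "\<bar>t\<bar> < \<delta>" for t
        using eq[OF inU[OF that b] b] by (simp add: shift)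
    qed (use fin \<delta> D_bnd b in auto)
    then show ?thesis by simp
  qed
  have D_int: "integrable M (\<lambda>z. D b (x - z))" "integrable N (\<lambda>z. D b (x - z))" if b: "b \<in> Basis" for b
    using D_bnd[of 0 _ b] b \<delta>(1)
    by (auto intro!: M.integrable_const_bound[where B = "(1 + \<bar>a - 2\<bar>) * \<epsilon> powr (a - 2)"]
                     N.integrable_const_bound[where B = "(1 + \<bar>a - 2\<bar>) * \<epsilon> powr (a - 2)"])
  have sum_D: "(\<Sum>b\<in>Basis. D b w) = (DIM('a) + a - 2) * norm w powr (a - 2)" if "w \<noteq> 0" for w
  proof -
    have "(\<Sum>b\<in>Basis. D b w) = DIM('a) * norm w powr (a - 2) + (a - 2) * (norm w powr (a - 4) * (w \<bullet> w))"
      by (simp add: D_def sum.distrib euclidean_inner[of w w] power2_eq_square mult.assoc flip: sum_distrib_left)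
    also have "norm w powr (a - 4) * (w \<bullet> w) = norm w powr (a - 2)"
      using powr_add[of "norm w" "a - 4" 2] that by (simp add: dot_square_norm)
    finally show ?thesis
      by (simp add: algebra_simps)
  qed
  have nz: "x - z \<noteq> 0" if "z \<in> space M \<union> space N" for z
    using far[OF x that] \<open>0 < \<epsilon>\<close> by auto
  have "(DIM('a) + a - 2) * (\<integral>z. norm (x - z) powr (a - 2) \<partial>M) = (\<integral>z. (\<Sum>b\<in>Basis. D b (x - z)) \<partial>M)"
    using nz sum_D by (simp cong: Bochner_Integration.integral_cong)
  also have "\<dots> = (\<integral>z. (\<Sum>b\<in>Basis. D b (x - z)) \<partial>N)"
    using D_int D_eq by simp
  also have "\<dots> = (DIM('a) + a - 2) * (\<integral>z. norm (x - z) powr (a - 2) \<partial>N)"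
    using nz sum_D by (simp cong: Bochner_Integration.integral_cong)
  finally show ?thesis using dim by simp
qed

text \<open>
  The engine of the proof: starting from the field \<open>(x - z) / \<bar>x - z\<bar>\<close>, divergence (with
  \<open>a = 1 - 2 m\<close>) and gradient (with \<open>a = - 1 - 2 m\<close>) alternate, lowering the exponent by 2 in each
  round. In odd dimension the iteration would break down at \<open>2 m = d - 1\<close>, where the kernel of the
  field is divergence free.
\<close>

lemma integral_norm_odd_powr_eq:
  fixes M N :: "'a::euclidean_space measure"
  assumes fin: "finite_measure M" "finite_measure N"
    and meas: "(\<lambda>z. z) \<in> borel_measurable M" "(\<lambda>z. z) \<in> borel_measurable N"
    and U: "open U" "0 < \<epsilon>" and far: "\<And>x z. x \<in> U \<Longrightarrow> z \<in> space M \<union> space N \<Longrightarrow> \<epsilon> \<le> norm (x - z)"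
    and dim: "even DIM('a)"
    and eq: "\<And>x b. x \<in> U \<Longrightarrow> b \<in> Basis \<Longrightarrow>
       (\<integral>z. norm (x - z) powr (-1) * ((x - z) \<bullet> b) \<partial>M) = (\<integral>z. norm (x - z) powr (-1) * ((x - z) \<bullet> b) \<partial>N)"
    and x: "x \<in> U"
  shows "(\<integral>z. norm (x - z) powr (- 1 - 2 * real m) \<partial>M) = (\<integral>z. norm (x - z) powr (- 1 - 2 * real m) \<partial>N)"
proof -
  have dim': "real DIM('a) + (1 - 2 * real m) \<noteq> 2" for m
  proof
    assume "real DIM('a) + (1 - 2 * real m) = 2"
    then have "real DIM('a) = real (2 * m + 1)" by simp
    then have "DIM('a) = 2 * m + 1" by (simp only: of_nat_eq_iff)
    then show False using dim by simp
  qed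
  have div: "(\<integral>z. norm (x - z) powr (- 1 - 2 * real m) \<partial>M) = (\<integral>z. norm (x - z) powr (- 1 - 2 * real m) \<partial>N)"
    if "\<And>x b. x \<in> U \<Longrightarrow> b \<in> Basis \<Longrightarrow>
       (\<integral>z. norm (x - z) powr (- 1 - 2 * real m) * ((x - z) \<bullet> b) \<partial>M)
     = (\<integral>z. norm (x - z) powr (- 1 - 2 * real m) * ((x - z) \<bullet> b) \<partial>N)" "x \<in> U" for m x
    using integral_divergence_norm_powr_eq[OF fin meas U far, of "1 - 2 * real m" x] dim'[of m] that
    by (simp add: algebra_simps)
  have "(\<integral>z. norm (x - z) powr (- 1 - 2 * real m) * ((x - z) \<bullet> b) \<partial>M)
      = (\<integral>z. norm (x - z) powr (- 1 - 2 * real m) * ((x - z) \<bullet> b) \<partial>N)" if "x \<in> U" "b \<in> Basis" for x b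
    using that
  proof (induction m arbitrary: x b)
    case 0
    then show ?case using eq by simp
  next
    case (Suc m)
    have "(\<integral>z. norm (x - z) powr (- 1 - 2 * real m - 2) * ((x - z) \<bullet> b) \<partial>M)
        = (\<integral>z. norm (x - z) powr (- 1 - 2 * real m - 2) * ((x - z) \<bullet> b) \<partial>N)"
    proof (rule integral_gradient_norm_powr_eq[OF fin meas U far])
      show "(\<integral>z. norm (y - z) powr (- 1 - 2 * real m) \<partial>M) = (\<integral>z. norm (y - z) powr (- 1 - 2 * real m) \<partial>N)"
        if "y \<in> U" for y
        by (rule div[OF Suc.IH that])
    qed (use Suc.prems in simp_all)
    moreover have "- 1 - 2 * real m - 2 = - 1 - 2 * real (Suc m)" by simp
    ultimately show ?case by (simp only:)
  qed
  then show ?thesis using div x by blast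
qed

section \<open>From inverse odd powers to Gaussians\<close>

text \<open>
  With \<open>u = 1 / \<bar>x - z\<bar>\<^sup>2\<close> the kernel of exponent \<open>- 1 - 2 m\<close> is \<open>\<bar>x - z\<bar>\<^sup>-\<^sup>1 u\<^sup>m\<close>, and the Gaussian
  is \<open>\<bar>x - z\<bar>\<^sup>-\<^sup>1 \<phi> u\<close> with \<open>\<phi> u = exp (- t / u) / sqrt u\<close>. Since \<open>\<phi>\<close> extends continuously by \<open>0\<close>
  to \<open>u = 0\<close>, it is a uniform limit of polynomials on the compact range of \<open>u\<close>.
\<close>

lemma integral_gaussian_eq:
  fixes M N :: "'a::euclidean_space measure"
  assumes fin: "finite_measure M" "finite_measure N"
    and meas [measurable]: "(\<lambda>z. z) \<in> borel_measurable M" "(\<lambda>z. z) \<in> borel_measurable N"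
    and "0 < \<epsilon>" and far: "\<And>z. z \<in> space M \<union> space N \<Longrightarrow> \<epsilon> \<le> norm (x - z)"
    and eq: "\<And>m. (\<integral>z. norm (x - z) powr (- 1 - 2 * real m) \<partial>M) = (\<integral>z. norm (x - z) powr (- 1 - 2 * real m) \<partial>N)"
    and "0 < t"
  shows "(\<integral>z. exp (- t * (norm (x - z))\<^sup>2) \<partial>M) = (\<integral>z. exp (- t * (norm (x - z))\<^sup>2) \<partial>N)"
proof (rule integral_eq_of_uniform_approx[OF fin])
  interpret M: finite_measure M by fact
  interpret N: finite_measure N by fact
  show "integrable M (\<lambda>z. exp (- t * (norm (x - z))\<^sup>2))"
    by (rule M.integrable_const_bound[where B = 1]) (use \<open>0 < t\<close> in auto)
  show "integrable N (\<lambda>z. exp (- t * (norm (x - z))\<^sup>2))"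
    by (rule N.integrable_const_bound[where B = 1]) (use \<open>0 < t\<close> in auto)
  have pow_int: "integrable M (\<lambda>z. norm (x - z) powr (- 1 - 2 * real m))"
                "integrable N (\<lambda>z. norm (x - z) powr (- 1 - 2 * real m))" for m
    using far \<open>0 < \<epsilon>\<close>
    by (auto intro!: M.integrable_const_bound[where B = "\<epsilon> powr (- 1 - 2 * real m)"]
                     N.integrable_const_bound[where B = "\<epsilon> powr (- 1 - 2 * real m)"] AE_I2 powr_mono2')
  define \<phi> where "\<phi> u = (if u = 0 then 0 else exp (- t / u) / sqrt u)" for u
  have \<phi>_bnd: "\<bar>\<phi> u\<bar> \<le> sqrt u / t" if "0 \<le> u" for u
  proof (cases "u = 0")
    case False
    with that have "u > 0" by simp
    have "t / u \<le> exp (t / u)"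
      using exp_ge_add_one_self[of "t / u"] by linarith
    then have "exp (- t / u) \<le> u / t"
      using \<open>u > 0\<close> \<open>t > 0\<close> by (simp add: exp_minus field_simps)
    then have "exp (- t / u) / sqrt u \<le> (u / t) / sqrt u"
      using \<open>u > 0\<close> by (intro divide_right_mono) auto
    also have "\<dots> = sqrt u / t"
      using real_div_sqrt[of u] \<open>u > 0\<close> by (metis less_imp_le divide_divide_eq_left mult.commute)
    finally show ?thesis using \<open>u > 0\<close> by (simp add: \<phi>_def)
  qed (simp add: \<phi>_def)
  define I where "I = {0 .. 1 / \<epsilon>\<^sup>2}"
  have \<phi>_cont: "continuous_on I \<phi>"
    unfolding continuous_on_eq_continuous_within
  proof
    fix u assume "u \<in> I"
    show "continuous (at u within I) \<phi>"
    proof (cases "u = 0")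
      case True
      have "((\<lambda>v. sqrt v / t) \<longlongrightarrow> sqrt 0 / t) (at 0 within I)"
        by (intro tendsto_intros) (use \<open>0 < t\<close> in auto)
      then have "((\<lambda>v. sqrt v / t) \<longlongrightarrow> 0) (at 0 within I)"
        by simp
      moreover have "\<forall>\<^sub>F v in at 0 within I. norm (\<phi> v) \<le> sqrt v / t"
        unfolding eventually_at_filter by (rule always_eventually) (simp add: I_def \<phi>_bnd)
      ultimately have "(\<phi> \<longlongrightarrow> 0) (at 0 within I)"
        by (metis Lim_null_comparison)
      then show ?thesis
        using True by (simp add: continuous_within \<phi>_def)
    next
      case False
      with \<open>u \<in> I\<close> have "u > 0" by (simp add: I_def)
      have "isCont (\<lambda>u. exp (- t / u) / sqrt u) u"
        using \<open>u > 0\<close> by (intro continuous_intros) auto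
      moreover have "\<forall>\<^sub>F v in nhds u. \<phi> v = exp (- t / v) / sqrt v"
        using \<open>u > 0\<close> by (auto simp: eventually_nhds \<phi>_def intro!: exI[of _ "{0<..}"])
      ultimately have "isCont \<phi> u"
        by (simp add: isCont_cong)
      then show ?thesis
        by (rule continuous_at_imp_continuous_at_within)
    qed
  qed
  fix e :: real assume "0 < e"
  obtain p where p: "real_polynomial_function p" "\<And>u. u \<in> I \<Longrightarrow> \<bar>\<phi> u - p u\<bar> < e * \<epsilon>"
    using Stone_Weierstrass_real_polynomial_function[OF _ \<phi>_cont, of "e * \<epsilon>"] \<open>0 < e\<close> \<open>0 < \<epsilon>\<close>
    by (auto simp: I_def)
  from p(1) obtain a n where p_sum: "p = (\<lambda>u. \<Sum>i\<le>n. a i * u ^ i)"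
    by (auto simp: real_polynomial_function_iff_sum)
  let ?g = "\<lambda>z. \<Sum>i\<le>n. a i * norm (x - z) powr (- 1 - 2 * real i)"
  have approx: "\<bar>exp (- t * (norm (x - z))\<^sup>2) - ?g z\<bar> \<le> e" if "z \<in> space M \<union> space N" for z
  proof -
    let ?r = "norm (x - z)"
    define u where "u = 1 / ?r\<^sup>2"
    have r: "\<epsilon> \<le> ?r" "0 < ?r" using far[OF that] \<open>0 < \<epsilon>\<close> by linarith+
    have "u \<in> I"
      using r \<open>0 < \<epsilon>\<close> by (auto simp: u_def I_def intro!: frac_le power_mono)
    have sq: "sqrt u = 1 / ?r" using r by (simp add: u_def real_sqrt_divide)
    have f_eq: "exp (- t * ?r\<^sup>2) = \<phi> u / ?r"
      unfolding \<phi>_def sq using r by (simp add: u_def)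
    have "?r powr (- 1 - 2 * real i) = u ^ i / ?r" for i
    proof -
      have "?r powr (- 1 - 2 * real i) = inverse (?r powr (1 + real (2 * i)))"
        by (simp flip: powr_minus)
      also have "?r powr (1 + real (2 * i)) = ?r * (?r\<^sup>2) ^ i"
        using r unfolding powr_add powr_realpow[OF r(2)] power_mult by simp
      also have "inverse (?r * (?r\<^sup>2) ^ i) = u ^ i / ?r"
        by (simp add: u_def power_one_over inverse_eq_divide)
      finally show ?thesis .
    qed
    then have g_eq: "?g z = p u / ?r"
      by (simp add: p_sum sum_divide_distrib)
    have "\<bar>exp (- t * ?r\<^sup>2) - ?g z\<bar> = \<bar>\<phi> u - p u\<bar> / ?r"
      unfolding f_eq g_eq using r by (simp flip: diff_divide_distrib)
    also have "\<dots> \<le> (e * \<epsilon>) / \<epsilon>"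
      by (rule frac_le) (use p(2)[OF \<open>u \<in> I\<close>] r \<open>0 < \<epsilon>\<close> \<open>0 < e\<close> in auto)
    finally show ?thesis using \<open>0 < \<epsilon>\<close> by simp
  qed
  show "\<exists>g. integrable M g \<and> integrable N g \<and> integral\<^sup>L M g = integral\<^sup>L N g
          \<and> (\<forall>z \<in> space M \<union> space N. \<bar>exp (- t * (norm (x - z))\<^sup>2) - g z\<bar> \<le> e)"
  proof (intro exI[of _ ?g] conjI ballI)
    show "integral\<^sup>L M ?g = integral\<^sup>L N ?g"
      using pow_int eq by simp
  qed (use pow_int approx in auto)
qed

section \<open>Gaussians with centres in a convex open set determine a measure\<close>

text \<open>
  The linear span of Gaussians; admitting \<open>t = 0\<close> puts the constants into it.
\<close>

inductive_set gaussian_span :: "'a::euclidean_space set \<Rightarrow> ('a \<Rightarrow> real) set" for C where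
  gaussian: "0 \<le> t \<Longrightarrow> x \<in> C \<Longrightarrow> (\<lambda>z. c * exp (- t * (norm (x - z))\<^sup>2)) \<in> gaussian_span C"
| add: "f \<in> gaussian_span C \<Longrightarrow> g \<in> gaussian_span C \<Longrightarrow> (\<lambda>z. f z + g z) \<in> gaussian_span C"

text \<open>
  The parallel-axis identity at the barycentre \<open>w\<close>; exponentiated, it says that a product of two
  Gaussians is a multiple of a Gaussian centred at \<open>w\<close>.
\<close>

lemma weighted_square_norms_barycentre:
  fixes x y z :: "'a::euclidean_space"
  assumes "t + s \<noteq> 0" "w = (t / (t + s)) *\<^sub>R x + (s / (t + s)) *\<^sub>R y"
  shows "t * (norm (x - z))\<^sup>2 + s * (norm (y - z))\<^sup>2
       = (t + s) * (norm (w - z))\<^sup>2 + t * s / (t + s) * (norm (x - y))\<^sup>2"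
proof -
  have ts: "t / (t + s) + s / (t + s) = 1"
    using assms(1) by (simp flip: add_divide_distrib)
  define u v where "u = x - z" and "v = y - z"
  have wz: "w - z = (1 / (t + s)) *\<^sub>R (t *\<^sub>R u + s *\<^sub>R v)"
  proof -
    have "w - z = (t / (t + s)) *\<^sub>R x + (s / (t + s)) *\<^sub>R y - (t / (t + s) + s / (t + s)) *\<^sub>R z"
      unfolding ts using assms(2) by simp
    also have "\<dots> = (1 / (t + s)) *\<^sub>R (t *\<^sub>R u + s *\<^sub>R v)"
      by (simp add: u_def v_def algebra_simps)
    finally show ?thesis .
  qed
  have "(t + s) * (norm (w - z))\<^sup>2 = (norm (t *\<^sub>R u + s *\<^sub>R v))\<^sup>2 / (t + s)"
    unfolding wz using assms(1) by (simp add: power_mult_distrib power_divide power2_eq_square)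
  moreover have "x - y = u - v" by (simp add: u_def v_def)
  moreover have "t * (norm u)\<^sup>2 + s * (norm v)\<^sup>2
      = (norm (t *\<^sub>R u + s *\<^sub>R v))\<^sup>2 / (t + s) + t * s / (t + s) * (norm (u - v))\<^sup>2"
  proof -
    have "(t * (norm u)\<^sup>2 + s * (norm v)\<^sup>2) * (t + s) = (norm (t *\<^sub>R u + s *\<^sub>R v))\<^sup>2 + t * s * (norm (u - v))\<^sup>2"
      by (simp add: power2_norm_eq_inner inner_add inner_diff inner_commute algebra_simps)
    then show ?thesis
      using assms(1) by (simp add: eq_divide_eq flip: add_divide_distrib)
  qed
  ultimately show ?thesis by (simp add: u_def v_def)
qed

lemma gaussian_span_mult:
  assumes "convex C" and f: "f \<in> gaussian_span C" and g: "g \<in> gaussian_span C"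
  shows "(\<lambda>z. f z * g z) \<in> gaussian_span C"
  using f
proof induction
  case (gaussian t x c)
  note tx = \<open>0 \<le> t\<close> \<open>x \<in> C\<close>
  show ?case
    using g
  proof induction
    case (gaussian s y d)
    show ?case
    proof (cases "t + s = 0")
      case True
      then have "t = 0" "s = 0" using tx gaussian by auto
      then show ?thesis
        using gaussian_span.gaussian[of 0 x C "c * d"] tx by simp
    next
      case False
      then have pos: "t + s > 0" using tx gaussian by linarith
      define w where "w = (t / (t + s)) *\<^sub>R x + (s / (t + s)) *\<^sub>R y"
      have "w \<in> C"
        unfolding w_def using pos tx gaussian
        by (intro convexD[OF \<open>convex C\<close>]) (auto simp flip: add_divide_distrib)
      have "(\<lambda>z. c * exp (- t * (norm (x - z))\<^sup>2) * (d * exp (- s * (norm (y - z))\<^sup>2)))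
          = (\<lambda>z. c * d * exp (- (t * s / (t + s) * (norm (x - y))\<^sup>2)) * exp (- (t + s) * (norm (w - z))\<^sup>2))"
      proof
        fix z
        have "- t * (norm (x - z))\<^sup>2 + - s * (norm (y - z))\<^sup>2
            = - (t * s / (t + s) * (norm (x - y))\<^sup>2) + - (t + s) * (norm (w - z))\<^sup>2"
          using weighted_square_norms_barycentre[OF False w_def, of z] by linarith
        then have "exp (- t * (norm (x - z))\<^sup>2) * exp (- s * (norm (y - z))\<^sup>2)
            = exp (- (t * s / (t + s) * (norm (x - y))\<^sup>2)) * exp (- (t + s) * (norm (w - z))\<^sup>2)"
          by (simp only: mult_exp_exp)
        then show "c * exp (- t * (norm (x - z))\<^sup>2) * (d * exp (- s * (norm (y - z))\<^sup>2))
          = c * d * exp (- (t * s / (t + s) * (norm (x - y))\<^sup>2)) * exp (- (t + s) * (norm (w - z))\<^sup>2)"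
          by (simp only: mult.assoc mult.left_commute)
      qed
      then show ?thesis
        using gaussian_span.gaussian[of "t + s" w C] pos \<open>w \<in> C\<close> by simp
    qed
  next
    case (add f g)
    then show ?case by (simp add: distrib_left gaussian_span.add)
  qed
next
  case (add f1 f2)
  then show ?case by (simp add: distrib_right gaussian_span.add)
qed

lemma gaussian_span_integrable:
  assumes "finite_measure M" and [measurable]: "(\<lambda>z. z) \<in> borel_measurable M" and "f \<in> gaussian_span C"
  shows "integrable M f"
  using assms(3)
proof induction
  case (gaussian t x c)
  interpret finite_measure M by fact
  show ?case
    by (rule integrable_const_bound[where B = "\<bar>c\<bar>"]) (use gaussian in \<open>auto simp: abs_mult mult_left_le\<close>)
qed simp

text \<open>
  The inverse stereographic projection onto the sphere of radius \<open>1/2\<close> around \<open>(0, 1/2)\<close>, which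
  serves as a concrete one-point compactification; the point at infinity is \<open>0\<close>.
\<close>

definition to_sphere :: "'a::euclidean_space \<Rightarrow> 'a \<times> real" where
  "to_sphere z = ((1 / (1 + (norm z)\<^sup>2)) *\<^sub>R z, 1 / (1 + (norm z)\<^sup>2))"

definition of_sphere :: "'a::euclidean_space \<times> real \<Rightarrow> 'a" where
  "of_sphere p = (1 / snd p) *\<^sub>R fst p"

definition compact_sphere :: "('a::euclidean_space \<times> real) set" where
  "compact_sphere = {p. (norm (fst p))\<^sup>2 + (snd p)\<^sup>2 = snd p}"

lemma one_plus_norm_square_pos: "0 < 1 + (norm z)\<^sup>2"
  by (simp add: add_pos_nonneg)

lemma of_sphere_to_sphere: "of_sphere (to_sphere z) = z"
  using one_plus_norm_square_pos[of z] by (simp add: of_sphere_def to_sphere_def)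

lemma to_sphere_in_compact_sphere: "to_sphere z \<in> compact_sphere"
proof -
  have "(norm z / (1 + (norm z)\<^sup>2))\<^sup>2 + (1 / (1 + (norm z)\<^sup>2))\<^sup>2
      = (1 + (norm z)\<^sup>2) / (1 + (norm z)\<^sup>2)\<^sup>2"
    by (simp add: power_divide add_divide_distrib)
  also have "\<dots> = 1 / (1 + (norm z)\<^sup>2)"
    using one_plus_norm_square_pos[of z] by (simp add: power2_eq_square[of "1 + _"])
  finally show ?thesis
    by (simp add: to_sphere_def compact_sphere_def del: power_one_over)
qed

lemma compact_compact_sphere: "compact (compact_sphere :: ('a::euclidean_space \<times> real) set)"
proof -
  have "closed (compact_sphere :: ('a \<times> real) set)"
    unfolding compact_sphere_def by (intro closed_Collect_eq continuous_intros)
  moreover have "norm p \<le> 1" if "p \<in> compact_sphere" for p :: "'a \<times> real"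
  proof -
    have eq: "(norm (fst p))\<^sup>2 + (snd p)\<^sup>2 = snd p"
      using that by (simp add: compact_sphere_def)
    then have "(snd p)\<^sup>2 \<le> snd p"
      by (metis le_add_same_cancel2 zero_le_power2)
    then have "snd p \<le> 1"
      by (simp add: power2_eq_square) (smt (verit) mult_le_cancel_left2 mult_nonneg_nonneg)
    then show ?thesis
      using eq by (simp add: norm_prod_def)
  qed
  then have "bounded (compact_sphere :: ('a \<times> real) set)"
    unfolding bounded_iff by blast
  ultimately show ?thesis
    by (simp add: compact_eq_bounded_closed)
qed

lemma compact_sphere_cases:
  assumes "p \<in> compact_sphere"
  obtains "p = 0" | "0 < snd p" "(norm (of_sphere p))\<^sup>2 = 1 / snd p - 1"
proof -
  have eq: "(norm (fst p))\<^sup>2 + (snd p)\<^sup>2 = snd p"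
    using assms by (simp add: compact_sphere_def)
  then have "snd p \<ge> 0"
    by (metis add_nonneg_nonneg zero_le_power2)
  then consider "snd p = 0" | "snd p > 0" by linarith
  then show ?thesis
  proof cases
    case 1
    then have "p = 0" using eq by (simp add: prod_eq_iff)
    then show ?thesis by (rule that)
  next
    case 2
    have "(norm (of_sphere p))\<^sup>2 = (norm (fst p))\<^sup>2 / (snd p)\<^sup>2"
      using 2 by (simp add: of_sphere_def power_divide)
    also have "(norm (fst p))\<^sup>2 = snd p - (snd p)\<^sup>2" using eq by linarith
    also have "(snd p - (snd p)\<^sup>2) / (snd p)\<^sup>2 = 1 / snd p - 1"
      using 2 by (simp add: diff_divide_distrib power2_eq_square)
    finally show ?thesis using 2 that by blast
  qed
qed

text \<open>
  The Gaussian transported to the sphere, with its limit \<open>0\<close> at the point at infinity.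
\<close>

definition sphere_gaussian :: "real \<Rightarrow> 'a::euclidean_space \<Rightarrow> 'a \<times> real \<Rightarrow> real" where
  "sphere_gaussian t x p = (if snd p = 0 then 0 else exp (- t * (norm (x - of_sphere p))\<^sup>2))"

lemma sphere_gaussian_to_sphere: "sphere_gaussian t x (to_sphere z) = exp (- t * (norm (x - z))\<^sup>2)"
  using one_plus_norm_square_pos[of z]
  by (simp add: sphere_gaussian_def of_sphere_to_sphere) (simp add: to_sphere_def)

text \<open>
  Only the point at infinity is delicate. There \<open>\<bar>z\<bar>\<^sup>2 = 1 / b - 1\<close>, where \<open>b\<close> is the last coordinate,
  so \<open>\<bar>x - z\<bar>\<^sup>2\<close> grows at least like \<open>1 / (2 b)\<close> and the Gaussian is \<open>O(b)\<close>.
\<close>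

lemma continuous_on_sphere_gaussian:
  fixes x :: "'a::euclidean_space"
  assumes "0 < t"
  shows "continuous_on compact_sphere (sphere_gaussian t x)"
  unfolding continuous_on_eq_continuous_within
proof
  fix p :: "'a \<times> real" assume p: "p \<in> compact_sphere"
  define K where "K = exp (t * ((norm x)\<^sup>2 + 1 / 2)) * (2 / t)"
  have bnd: "\<bar>sphere_gaussian t x q\<bar> \<le> K * snd q" if "q \<in> compact_sphere" for q :: "'a \<times> real"
    using that
  proof (cases rule: compact_sphere_cases)
    case 2
    let ?y = "of_sphere q" and ?b = "snd q"
    have "(norm ?y)\<^sup>2 \<le> (norm (x - ?y) + norm x)\<^sup>2"
      using norm_triangle_ineq4[of x "x - ?y"] by (intro power_mono) auto
    also have "\<dots> \<le> 2 * (norm (x - ?y))\<^sup>2 + 2 * (norm x)\<^sup>2"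
      using sum_squares_bound[of "norm (x - ?y)" "norm x"] by (simp add: power2_sum)
    finally have "1 / ?b - 1 \<le> 2 * (norm (x - ?y))\<^sup>2 + 2 * (norm x)\<^sup>2"
      using 2 by simp
    then have "1 / (2 * ?b) - ((norm x)\<^sup>2 + 1 / 2) \<le> (norm (x - ?y))\<^sup>2"
      by simp
    then have "t * (1 / (2 * ?b) - ((norm x)\<^sup>2 + 1 / 2)) \<le> t * (norm (x - ?y))\<^sup>2"
      using \<open>0 < t\<close> by (intro mult_left_mono) auto
    then have "exp (- t * (norm (x - ?y))\<^sup>2) \<le> exp (t * ((norm x)\<^sup>2 + 1 / 2)) * exp (- (t / (2 * ?b)))"
      by (simp add: right_diff_distrib flip: exp_add)
    also have "exp (- (t / (2 * ?b))) \<le> 2 * ?b / t"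
      using exp_ge_add_one_self[of "t / (2 * ?b)"] 2 \<open>0 < t\<close>
      by (simp add: exp_minus field_simps) 
    finally show ?thesis
      using 2 by (simp add: sphere_gaussian_def K_def)
  qed (simp add: sphere_gaussian_def)
  from p show "continuous (at p within compact_sphere) (sphere_gaussian t x)"
  proof (cases rule: compact_sphere_cases)
    case 1
    have "((\<lambda>q. K * snd q) \<longlongrightarrow> K * snd p) (at p within compact_sphere)"
      by (intro tendsto_intros)
    then have "((\<lambda>q. K * snd q) \<longlongrightarrow> 0) (at p within compact_sphere)"
      using 1 by simp
    moreover have "\<forall>\<^sub>F q in at p within compact_sphere. norm (sphere_gaussian t x q) \<le> K * snd q"
      unfolding eventually_at_filter by (rule always_eventually) (simp add: bnd)
    ultimately have "(sphere_gaussian t x \<longlongrightarrow> 0) (at p within compact_sphere)"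
      by (metis Lim_null_comparison)
    then show ?thesis
      using 1 by (simp add: continuous_within sphere_gaussian_def)
  next
    case 2
    have "isCont (\<lambda>q. exp (- t * (norm (x - of_sphere q))\<^sup>2)) p"
      unfolding of_sphere_def using 2 by (intro continuous_intros) auto
    moreover have "\<forall>\<^sub>F q in nhds p. sphere_gaussian t x q = exp (- t * (norm (x - of_sphere q))\<^sup>2)"
    proof -
      have "open {q :: 'a \<times> real. snd q \<noteq> 0}"
        by (intro open_Collect_neq continuous_intros)
      then show ?thesis
        using 2 by (auto simp: eventually_nhds sphere_gaussian_def intro!: exI[of _ "{q. snd q \<noteq> 0}"])
    qed
    ultimately have "isCont (sphere_gaussian t x) p"
      by (simp add: isCont_cong)
    then show ?thesis
      by (rule continuous_at_imp_continuous_at_within)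
  qed
qed

text \<open>
  If \<open>y\<close> and \<open>z\<close> are equidistant from some point of \<open>C\<close>, moving that point in the direction
  \<open>y - z\<close> leaves their bisecting hyperplane.
\<close>

lemma gaussians_separate_points:
  fixes y z :: "'a::euclidean_space"
  assumes "open C" "C \<noteq> {}" "y \<noteq> z"
  shows "\<exists>x\<in>C. norm (x - y) \<noteq> norm (x - z)"
proof -
  obtain x0 where "x0 \<in> C" using assms by auto
  obtain \<delta> where \<delta>: "0 < \<delta>" "cball x0 \<delta> \<subseteq> C"
    using \<open>open C\<close> \<open>x0 \<in> C\<close> open_contains_cball by blast
  define x1 where "x1 = x0 + (\<delta> / norm (y - z)) *\<^sub>R (y - z)"
  have "dist x0 x1 = \<delta>"
    using \<delta>(1) \<open>y \<noteq> z\<close> by (simp add: x1_def dist_norm)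
  then have "x1 \<in> C" using \<delta>(2) by auto
  have sq: "(norm (x - y))\<^sup>2 - (norm (x - z))\<^sup>2 = (norm y)\<^sup>2 - (norm z)\<^sup>2 - 2 * (x \<bullet> (y - z))" for x
    by (simp add: power2_norm_eq_inner inner_diff inner_commute)
  have "norm (x0 - y) \<noteq> norm (x0 - z) \<or> norm (x1 - y) \<noteq> norm (x1 - z)"
  proof (rule ccontr)
    assume "\<not> ?thesis"
    then have "x0 \<bullet> (y - z) = x1 \<bullet> (y - z)"
      using sq[of x0] sq[of x1] by simp
    then have "\<delta> / norm (y - z) * ((y - z) \<bullet> (y - z)) = 0"
      by (simp add: x1_def inner_add_left)
    then show False using \<delta>(1) \<open>y \<noteq> z\<close> by simp
  qed
  then show ?thesis using \<open>x0 \<in> C\<close> \<open>x1 \<in> C\<close> by blast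
qed

text \<open>
  Convexity of \<open>C\<close> makes the span of the Gaussians an algebra. Transported to the compact sphere it
  satisfies the hypotheses of the Stone-Weierstrass theorem, so the images of both measures on the
  sphere integrate all continuous functions equally and coincide; projecting back gives the claim.
  The case \<open>t = 0\<close> of the hypothesis, equality of total masses, provides the constants.
\<close>

theorem measure_eqI_gaussian:
  fixes M N :: "'a::euclidean_space measure"
  assumes fin: "finite_measure M" "finite_measure N"
    and M: "sets M = sets borel" and N: "sets N = sets borel"
    and C: "open C" "convex C" "C \<noteq> {}"
    and eq: "\<And>t x. 0 \<le> t \<Longrightarrow> x \<in> C \<Longrightarrow>
       (\<integral>z. exp (- t * (norm (x - z))\<^sup>2) \<partial>M) = (\<integral>z. exp (- t * (norm (x - z))\<^sup>2) \<partial>N)"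
  shows "M = N"
proof -
  note [measurable_cong] = M N
  interpret M: finite_measure M by fact
  interpret N: finite_measure N by fact
  obtain x0 where "x0 \<in> C" using C by auto
  have span_eq: "integral\<^sup>L M f = integral\<^sup>L N f" if "f \<in> gaussian_span C" for f
    using that
  proof induction
    case (add f g)
    then show ?case by (simp add: fin gaussian_span_integrable)
  qed (use eq in simp)
  define R where "R = {g :: 'a \<times> real \<Rightarrow> real. continuous_on compact_sphere g \<and> (\<lambda>z. g (to_sphere z)) \<in> gaussian_span C}"
  have gauss_R: "sphere_gaussian t x \<in> R" if "0 < t" "x \<in> C" for t x
    using that gaussian_span.gaussian[of t x C 1]
    by (simp add: R_def continuous_on_sphere_gaussian sphere_gaussian_to_sphere)
  interpret R: function_ring_on R compact_sphere
  proof unfold_locales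
    show "(\<lambda>_. c) \<in> R" for c
      using gaussian_span.gaussian[of 0 x0 C c] \<open>x0 \<in> C\<close> by (simp add: R_def)
    show "\<exists>f\<in>R. f p \<noteq> f q" if "p \<in> compact_sphere" "q \<in> compact_sphere" "p \<noteq> q" for p q
      using that(1)
    proof (cases rule: compact_sphere_cases)
      case 1
      from that(2) have "snd q \<noteq> 0" by (cases rule: compact_sphere_cases) (use 1 that in auto)
      then show ?thesis
        using 1 \<open>x0 \<in> C\<close> by (intro bexI[OF _ gauss_R[of 1 x0]]) (auto simp: sphere_gaussian_def)
    next
      case p: 2
      from that(2) show ?thesis
      proof (cases rule: compact_sphere_cases)
        case 1
        then show ?thesis
          using p \<open>x0 \<in> C\<close> by (intro bexI[OF _ gauss_R[of 1 x0]]) (auto simp: sphere_gaussian_def)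
      next
        case q: 2
        have "of_sphere p \<noteq> of_sphere q"
        proof
          assume same: "of_sphere p = of_sphere q"
          then have "snd p = snd q" using p q by simp
          moreover from this same have "fst p = fst q" using p by (simp add: of_sphere_def)
          ultimately show False using \<open>p \<noteq> q\<close> by (simp add: prod_eq_iff)
        qed
        then obtain x where "x \<in> C" "norm (x - of_sphere p) \<noteq> norm (x - of_sphere q)"
          using gaussians_separate_points[OF C(1,3)] by blast
        then show ?thesis
          using p q by (intro bexI[OF _ gauss_R[of 1 x]]) (auto simp: sphere_gaussian_def)
      qed
    qed
  qed (simp_all add: R_def compact_compact_sphere gaussian_span.add gaussian_span_mult[OF C(2)]
         continuous_on_add continuous_on_mult)
  have cont: "continuous_on UNIV (to_sphere :: 'a \<Rightarrow> _)"
    unfolding to_sphere_def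
    by (intro continuous_intros) (use one_plus_norm_square_pos in \<open>metis less_irrefl\<close>)+
  have [measurable]: "(to_sphere :: 'a \<Rightarrow> _) \<in> borel_measurable borel"
    by (rule borel_measurable_continuous_onI[OF cont])
  have [measurable]: "(of_sphere :: 'a \<times> real \<Rightarrow> _) \<in> borel_measurable borel"
    unfolding of_sphere_def borel_prod[symmetric] by measurable
  have "distr M borel to_sphere = distr N borel to_sphere"
  proof (rule measure_eqI_continuous_bounded)
    fix f :: "'a \<times> real \<Rightarrow> real"
    assume f: "continuous_on UNIV f" "bounded (range f)"
    then have [measurable]: "f \<in> borel_measurable borel"
      by (intro borel_measurable_continuous_onI)
    obtain B where B: "\<And>p. \<bar>f p\<bar> \<le> B"
      using f(2) by (auto simp: bounded_iff)
    have "(\<integral>z. f (to_sphere z) \<partial>M) = (\<integral>z. f (to_sphere z) \<partial>N)"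
    proof (rule integral_eq_of_uniform_approx[OF fin])
      show "integrable M (\<lambda>z. f (to_sphere z))"
        by (rule M.integrable_const_bound[where B = B]) (use B in auto)
      show "integrable N (\<lambda>z. f (to_sphere z))"
        by (rule N.integrable_const_bound[where B = B]) (use B in auto)
      fix e :: real assume "0 < e"
      obtain g where g: "g \<in> R" "\<And>p. p \<in> compact_sphere \<Longrightarrow> \<bar>f p - g p\<bar> < e"
        using R.Stone_Weierstrass_basic[OF continuous_on_subset[OF f(1)] \<open>0 < e\<close>] by auto
      then have gs: "(\<lambda>z. g (to_sphere z)) \<in> gaussian_span C" by (simp add: R_def)
      show "\<exists>g. integrable M g \<and> integrable N g \<and> integral\<^sup>L M g = integral\<^sup>L N g
              \<and> (\<forall>z \<in> space M \<union> space N. \<bar>f (to_sphere z) - g z\<bar> \<le> e)"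
        by (rule exI[of _ "\<lambda>z. g (to_sphere z)"])
           (use gs span_eq fin less_imp_le[OF g(2)[OF to_sphere_in_compact_sphere]] in
             \<open>auto intro!: gaussian_span_integrable\<close>)
    qed
    then show "integral\<^sup>L (distr M borel to_sphere) f = integral\<^sup>L (distr N borel to_sphere) f"
      by (simp add: integral_distr)
  qed (auto intro!: M.finite_measure_distr N.finite_measure_distr)
  then have "distr (distr M borel to_sphere) borel of_sphere = distr (distr N borel to_sphere) borel of_sphere"
    by simp
  then have "distr M borel (\<lambda>z. z) = distr N borel (\<lambda>z. z)"
    by (simp add: distr_distr o_def of_sphere_to_sphere)
  then show ?thesis
    using M N by (simp add: distr_id2)
qed

section \<open>The geometric cdf determines the measure\<close>

lemma integral_split_restrict_space:
  fixes f :: "'a::euclidean_space \<Rightarrow> real"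
  assumes "finite_measure P" and P: "sets P = sets borel" and B: "B \<in> sets borel"
    and f: "f \<in> borel_measurable borel" "\<And>z. \<bar>f z\<bar> \<le> K"
  shows "(\<integral>z. f z \<partial>P) = (\<integral>z. f z \<partial>restrict_space P B) + (\<integral>z. f z \<partial>restrict_space P (- B))"
proof -
  interpret finite_measure P by fact
  note [measurable_cong] = P
  note [measurable] = B f(1)
  have sp: "space P = UNIV" using sets_eq_imp_space_eq[OF P] by simp
  have int: "integrable P (\<lambda>z. indicator A z * f z)" if [measurable]: "A \<in> sets borel" for A
  proof (rule integrable_const_bound[where B = K], rule AE_I2)
    show "norm (indicator A z * f z) \<le> K" for z
      using f(2)[of z] order_trans[OF abs_ge_zero f(2)[of z]] by (cases "z \<in> A") simp_all
  qed measurable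
  have "(\<integral>z. f z \<partial>P) = (\<integral>z. indicator B z * f z + indicator (- B) z * f z \<partial>P)"
    by (intro Bochner_Integration.integral_cong) (auto simp: indicator_def)
  also have "\<dots> = (\<integral>z. indicator B z * f z \<partial>P) + (\<integral>z. indicator (- B) z * f z \<partial>P)"
    by (intro Bochner_Integration.integral_add int) auto
  finally show ?thesis
    using B P sp by (simp add: integral_restrict_space)
qed

text \<open>
  The excluded case \<open>z = x\<close> needs no indicator on the right, because the inner product vanishes there.
\<close>

lemma geometric_cdf_inner:
  assumes "finite_measure P" and P: "sets P = sets borel"
  shows "geometric_cdf P x \<bullet> b = (\<integral>z. norm (x - z) powr (-1) * ((x - z) \<bullet> b) \<partial>P)"
proof -
  interpret finite_measure P by fact
  note [measurable_cong] = P
  have "norm ((x - z) /\<^sub>R norm (x - z)) \<le> 1" for z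
    by (cases "x = z") auto
  then have "integrable P (\<lambda>z. indicator {z. z \<noteq> x} z *\<^sub>R ((x - z) /\<^sub>R norm (x - z)))"
    by (intro integrable_const_bound[where B = 1]) (auto simp: indicator_def)
  then have "geometric_cdf P x \<bullet> b
      = (\<integral>z. (indicator {z. z \<noteq> x} z *\<^sub>R ((x - z) /\<^sub>R norm (x - z))) \<bullet> b \<partial>P)"
    unfolding geometric_cdf_def by (simp only: integral_inner_left)
  also have "\<dots> = (\<integral>z. norm (x - z) powr (-1) * ((x - z) \<bullet> b) \<partial>P)"
    by (intro Bochner_Integration.integral_cong) (auto simp: indicator_def powr_minus)
  finally show ?thesis .
qed

theorem proposition5p2:
  fixes P Q :: "(real ^ 'n) measure" and \<Omega> :: "(real ^ 'n) set"
  assumes "CARD('n) \<ge> 2" and "even CARD('n)"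
    and "prob_space P" and "sets P = sets borel"
    and "prob_space Q" and "sets Q = sets borel"
    and "open \<Omega>" and "\<Omega> \<noteq> {}"
    and "\<And>E. E \<in> sets borel \<Longrightarrow> E \<subseteq> \<Omega> \<Longrightarrow> emeasure P E = emeasure Q E"
    and "\<And>x. x \<in> \<Omega> \<Longrightarrow> geometric_cdf P x = geometric_cdf Q x"
  shows "P = Q"
proof -
  interpret P: prob_space P by fact
  interpret Q: prob_space Q by fact
  note P = \<open>sets P = sets borel\<close> and Q = \<open>sets Q = sets borel\<close>
  have sp: "space P = UNIV" "space Q = UNIV"
    using P Q by (auto dest: sets_eq_imp_space_eq)
  obtain x0 r where r: "0 < r" "ball x0 r \<subseteq> \<Omega>"
    using \<open>open \<Omega>\<close> \<open>\<Omega> \<noteq> {}\<close> by (meson all_not_in_conv openE)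
  define B U where "B = ball x0 r" and "U = ball x0 (r / 2)"
  have B: "B \<in> sets borel" "B \<subseteq> \<Omega>" and U: "open U" "U \<subseteq> \<Omega>" "convex U" "U \<noteq> {}"
    using r by (auto simp: B_def U_def subset_eq)
  have eq_B: "restrict_space P B = restrict_space Q B"
  proof (rule measure_eqI)
    show "sets (restrict_space P B) = sets (restrict_space Q B)"
      by (rule sets_restrict_space_cong) (simp add: P Q)
    fix E assume "E \<in> sets (restrict_space P B)"
    then have "E \<in> sets borel" "E \<subseteq> B"
      using B P by (auto simp: sets_restrict_space)
    then show "emeasure (restrict_space P B) E = emeasure (restrict_space Q B) E"
      using B P Q sp assms(9)[of E] by (simp add: emeasure_restrict_space)
  qed
  \<comment> \<open>Restricting to the complement of \<open>B\<close> keeps every kernel centred in \<open>U\<close> away from its singularity;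
    as \<open>P\<close> and \<open>Q\<close> agree on \<open>B\<close>, no comparison of integrals is affected.\<close>
  define M N where "M = restrict_space P (- B)" and "N = restrict_space Q (- B)"
  have MN_iff: "(\<integral>z. f z \<partial>P) = (\<integral>z. f z \<partial>Q) \<longleftrightarrow> (\<integral>z. f z \<partial>M) = (\<integral>z. f z \<partial>N)"
    if "f \<in> borel_measurable borel" "\<And>z. \<bar>f z\<bar> \<le> K" for f :: "real ^ 'n \<Rightarrow> real" and K
    using integral_split_restrict_space[OF P.finite_measure_axioms P B(1) that]
      integral_split_restrict_space[OF Q.finite_measure_axioms Q B(1) that]
    by (simp add: M_def N_def eq_B)
  have fin: "finite_measure M" "finite_measure N"
    unfolding M_def N_def using B P Q sp
    by (auto intro!: finite_measure_restrict_space P.finite_measure_axioms Q.finite_measure_axioms)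
  have meas: "(\<lambda>z. z) \<in> borel_measurable M" "(\<lambda>z. z) \<in> borel_measurable N"
    unfolding M_def N_def by (auto intro!: measurable_restrict_space1 simp: measurable_ident_sets P Q)
  have far: "r / 2 \<le> norm (x - z)" if "x \<in> U" "z \<in> space M \<union> space N" for x z
  proof -
    have "dist x0 x < r / 2" "r \<le> dist x0 z"
      using that by (auto simp: U_def M_def N_def B_def space_restrict_space)
    then show ?thesis
      using dist_triangle[of x0 z x] by (simp add: dist_norm)
  qed
  have grad: "(\<integral>z. norm (x - z) powr (-1) * ((x - z) \<bullet> b) \<partial>M) = (\<integral>z. norm (x - z) powr (-1) * ((x - z) \<bullet> b) \<partial>N)"
    if "x \<in> U" "b \<in> Basis" for x b
  proof -
    have "\<bar>norm (x - z) powr (-1) * ((x - z) \<bullet> b)\<bar> \<le> 1" for z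
      using Cauchy_Schwarz_ineq2[of "x - z" b] \<open>b \<in> Basis\<close>
      by (auto simp: abs_mult powr_minus_divide divide_le_eq_1)
    moreover have "(\<integral>z. norm (x - z) powr (-1) * ((x - z) \<bullet> b) \<partial>P) = (\<integral>z. norm (x - z) powr (-1) * ((x - z) \<bullet> b) \<partial>Q)"
      using assms(10)[of x] U that
        geometric_cdf_inner[OF P.finite_measure_axioms P, of x b]
        geometric_cdf_inner[OF Q.finite_measure_axioms Q, of x b] by auto
    ultimately show ?thesis
      using MN_iff[of "\<lambda>z. norm (x - z) powr (-1) * ((x - z) \<bullet> b)" 1] by simp
  qed
  have gauss_MN: "(\<integral>z. exp (- t * (norm (x - z))\<^sup>2) \<partial>M) = (\<integral>z. exp (- t * (norm (x - z))\<^sup>2) \<partial>N)"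
    if "x \<in> U" "0 < t" for x t
  proof (rule integral_gaussian_eq[OF fin meas _ far[OF \<open>x \<in> U\<close>] _ \<open>0 < t\<close>])
    show "(\<integral>z. norm (x - z) powr (- 1 - 2 * real m) \<partial>M) = (\<integral>z. norm (x - z) powr (- 1 - 2 * real m) \<partial>N)" for m
      by (rule integral_norm_odd_powr_eq[OF fin meas U(1) _ far _ grad \<open>x \<in> U\<close>])
         (use r \<open>even CARD('n)\<close> in simp_all)
  qed (use r in simp_all)
  show "P = Q"
  proof (rule measure_eqI_gaussian[OF P.finite_measure_axioms Q.finite_measure_axioms P Q U(1,3,4)])
    fix t :: real and x assume "0 \<le> t" "x \<in> U"
    show "(\<integral>z. exp (- t * (norm (x - z))\<^sup>2) \<partial>P) = (\<integral>z. exp (- t * (norm (x - z))\<^sup>2) \<partial>Q)"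
    proof (cases "t = 0")
      case True
      then show ?thesis by (simp add: P.prob_space Q.prob_space)
    next
      case False
      with \<open>0 \<le> t\<close> have "0 < t" by simp
      then show ?thesis
        using gauss_MN[OF \<open>x \<in> U\<close> \<open>0 < t\<close>] MN_iff[of "\<lambda>z. exp (- t * (norm (x - z))\<^sup>2)" 1] by simp
    qed
  qed
qed

end
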